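(* Fix $\alpha=1/M$ for any number $M\in\{2,3,\ldots\}$. Let $0<s<1$ and $1<p<\infty$ be such that $\alpha sp\ge1$. Then there exist a bounded open set $G$ in $\mathbb{R}$ and an $\alpha$-Hölder function $R:G\to\mathbb{R}$ which satisfies $0\le R(x)\le\operatorname{dist}(x,\partial G)$ whenever $x\in G$ and which has the following property: for any given $\sigma\in(\alpha s,1)$ there does not exist a constant $C>0$ such that $$|M_R(f)|_{W^{\sigma,p}(G)}\le C\,|f|_{W^{s,p}(G)}$$ for all functions $f\in L^p(G)$.
   Context: A function $R:G\to\mathbb{R}$ is $\alpha$-Hölder on $G$ if there exists $L\ge0$ such that $|R(x)-R(y)|\le L|x-y|^\alpha$ for all $x,y\in G$. For an open set $G\subset\mathbb{R}$, $f\in L^1_{\mathrm{loc}}(G)$ and $x\in G$, with $B(x,r)=(x-r,x+r)$, $$M_R(f)(x)=\sup_{0\le r\le R(x)}\frac{1}{|B(x,r)|}\int_{B(x,r)}|f(y)|\,dy,$$ where for $r=0$ the average is by convention equal to $|f(x)|$. For $0<t<1$ and $G\subset\mathbb{R}$ open, $$|f|_{W^{t,p}(G)}=\Big(\int_G\int_G\frac{|f(x)-f(y)|^p}{|x-y|^{1+tp}}\,dy\,dx\Big)^{1/p}.$$ *)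

theory Defs
  imports "HOL-Analysis.Analysis"
begin

definition holder_on :: "real \<Rightarrow> real set \<Rightarrow> (real \<Rightarrow> real) \<Rightarrow> bool" where
  "holder_on \<alpha> G R \<longleftrightarrow> (\<exists>L\<ge>0. \<forall>x\<in>G. \<forall>y\<in>G. \<bar>R x - R y\<bar> \<le> L * \<bar>x - y\<bar> powr \<alpha>)"

(* Functions on G are total functions whose values outside G play no role.
   Functions are not identified almost everywhere. *)
definition Lp_on :: "real \<Rightarrow> real set \<Rightarrow> (real \<Rightarrow> real) set" where
  "Lp_on p G = {f \<in> borel_measurable (lebesgue_on G). integrable (lebesgue_on G) (\<lambda>x. \<bar>f x\<bar> powr p)}"

definition ball_average :: "(real \<Rightarrow> real) \<Rightarrow> real \<Rightarrow> real \<Rightarrow> ennreal" where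
  "ball_average f x r =
     (if r = 0 then ennreal \<bar>f x\<bar>
      else (\<integral>\<^sup>+ y \<in> ball x r. ennreal \<bar>f y\<bar> \<partial>lebesgue) / emeasure lebesgue (ball x r))"

(* Extended-valued, since the supremum may be infinite at points where small balls are admitted.
   When ball x (R x) lies in G, only the values of f on G matter. *)
definition local_maximal :: "(real \<Rightarrow> real) \<Rightarrow> (real \<Rightarrow> real) \<Rightarrow> real \<Rightarrow> ennreal" where
  "local_maximal R f x = (SUP r\<in>{0..R x}. ball_average f x r)"

definition ennreal_powr :: "ennreal \<Rightarrow> real \<Rightarrow> ennreal" where
  "ennreal_powr a q = (if a = \<infinity> then \<infinity> else ennreal (enn2real a powr q))"

(* Takes the value infinity when the double integral diverges.  The integrand is 0 on the
   diagonal, because x / 0 = 0; the diagonal is a null set. *)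
definition sobolev_seminorm :: "real \<Rightarrow> real \<Rightarrow> real set \<Rightarrow> (real \<Rightarrow> real) \<Rightarrow> ennreal" where
  "sobolev_seminorm t p G f =
     ennreal_powr
       (\<integral>\<^sup>+ x \<in> G. (\<integral>\<^sup>+ y \<in> G. ennreal (\<bar>f x - f y\<bar> powr p / \<bar>x - y\<bar> powr (1 + t * p)) \<partial>lebesgue) \<partial>lebesgue)
       (1 / p)"

end

theory Submission
  imports Defs
begin

text \<open>
  On the dyadic interval from h = 2^(-k) to 2h of G = (0,2), let R be the power 1/M of the distance
  to a grid of mesh h^M.  Such a power of a distance is 1/M-Hoelder, and R sweeps the range from 0
  to about h within each cell of the grid.  Test with the distance to the midpoint of the interval,
  rescaled to length h and height 1: its p-energy of order s scales like h^(1 - sp).  Near the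
  midpoint the balls with R close to h reach the region where f = 1, and those with small R do not,
  so the maximal function oscillates by a fixed amount in every cell, and its p-energy of order
  \<sigma> is at least of the order h * h^(-M\<sigma>p).  The quotient is unbounded as h tends to 0 as soon
  as M\<sigma> > s.
\<close>

section \<open>Hoelder continuity of powers of a distance\<close>

text \<open>Since c \<le> c^\<alpha> for c in [0,1], the fractions a/(a+b) and b/(a+b), which sum to
  1, have \<alpha>-th powers summing to at least 1; multiplying by (a+b)^\<alpha> gives the
  claim.\<close>

lemma powr_add_le_real:
  fixes a b \<alpha> :: real
  assumes "0 \<le> a" "0 \<le> b" "0 < \<alpha>" "\<alpha> \<le> 1"
  shows "(a + b) powr \<alpha> \<le> a powr \<alpha> + b powr \<alpha>"
proof (cases "a + b = 0")
  case True
  with assms show ?thesis by simp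
next
  case False
  then have pos: "a + b > 0" using assms by simp
  have *: "c / (a + b) \<le> (c / (a + b)) powr \<alpha>" if "0 \<le> c" "c \<le> a + b" for c
  proof (cases "c = 0")
    case False
    then show ?thesis
      using powr_mono'[of \<alpha> 1 "c / (a + b)"] that pos assms by simp
  qed simp
  have "1 = a / (a + b) + b / (a + b)"
    using pos by (simp add: add_divide_distrib[symmetric])
  also have "\<dots> \<le> (a / (a + b)) powr \<alpha> + (b / (a + b)) powr \<alpha>"
    using *[of a] *[of b] assms by linarith
  also have "\<dots> = (a powr \<alpha> + b powr \<alpha>) / (a + b) powr \<alpha>"
    using assms pos by (simp add: powr_divide add_divide_distrib)
  finally show ?thesis using pos by (simp add: field_simps)
qed

lemma abs_powr_diff_le:
  fixes a b \<alpha> :: real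
  assumes "0 \<le> a" "0 \<le> b" "0 < \<alpha>" "\<alpha> \<le> 1"
  shows "\<bar>a powr \<alpha> - b powr \<alpha>\<bar> \<le> \<bar>a - b\<bar> powr \<alpha>"
  using assms
proof (induction a b rule: linorder_wlog)
  case (le a b)
  then have "b powr \<alpha> \<le> a powr \<alpha> + (b - a) powr \<alpha>" "a powr \<alpha> \<le> b powr \<alpha>"
    using powr_add_le_real[of a "b - a" \<alpha>] by (auto intro: powr_mono2)
  with le show ?case by simp
next
  case (sym a b)
  then show ?case by (simp add: abs_minus_commute)
qed

text \<open>The distance is 1-Lipschitz and t^\<alpha> is \<alpha>-Hoelder with constant 1 on the
  half-line, so L = 1 works for every set Z.\<close>

lemma holder_on_infdist_powr:
  assumes "0 < \<alpha>" "\<alpha> \<le> 1"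
  shows "holder_on \<alpha> G (\<lambda>x. infdist x Z powr \<alpha>)"
proof -
  have "\<bar>infdist x Z powr \<alpha> - infdist y Z powr \<alpha>\<bar> \<le> \<bar>x - y\<bar> powr \<alpha>" for x y
  proof -
    have "\<bar>infdist x Z powr \<alpha> - infdist y Z powr \<alpha>\<bar> \<le> \<bar>infdist x Z - infdist y Z\<bar> powr \<alpha>"
      using assms by (intro abs_powr_diff_le) (auto simp: infdist_nonneg)
    also have "\<dots> \<le> \<bar>x - y\<bar> powr \<alpha>"
      using assms infdist_triangle_abs[of x Z y] by (intro powr_mono2) (auto simp: dist_real_def)
    finally show ?thesis .
  qed
  then show ?thesis
    unfolding holder_on_def by (intro exI[of _ 1]) simp
qed

section \<open>Elementary bounds for extended powers, ball averages and the local maximal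
  function\<close>

lemma ennreal_powr_ennreal: "0 \<le> a \<Longrightarrow> ennreal_powr (ennreal a) q = ennreal (a powr q)"
  by (simp add: ennreal_powr_def)

lemma ennreal_powr_mono:
  assumes "a \<le> b" "0 \<le> q"
  shows "ennreal_powr a q \<le> ennreal_powr b q"
proof (cases "b = \<infinity>")
  case False
  with assms have "a \<noteq> \<infinity>" by (auto simp: top_unique)
  with False assms show ?thesis
    by (auto simp: ennreal_powr_def less_top intro!: ennreal_leI powr_mono2 enn2real_mono)
qed (simp add: ennreal_powr_def)

lemma emeasure_ball_real: "0 \<le> r \<Longrightarrow> emeasure lborel (ball x r) = ennreal (2 * r)" for x r :: real
  by (simp add: ball_eq_greaterThanLessThan)

lemma ball_average_le:
  assumes "0 \<le> B" "0 \<le> r" and "\<And>y. \<bar>y - x\<bar> \<le> r \<Longrightarrow> \<bar>f y\<bar> \<le> B"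
  shows "ball_average f x r \<le> ennreal B"
proof (cases "r = 0")
  case True
  then show ?thesis using assms(3)[of x] by (simp add: ball_average_def ennreal_leI)
next
  case False
  with assms have r: "r > 0" by simp
  have "(\<integral>\<^sup>+ y \<in> ball x r. ennreal \<bar>f y\<bar> \<partial>lebesgue) \<le> (\<integral>\<^sup>+ y. ennreal B * indicator (ball x r) y \<partial>lebesgue)"
    using assms
    by (intro nn_integral_mono) (auto split: split_indicator simp: dist_real_def intro!: ennreal_leI)
  also have "\<dots> = ennreal B * ennreal (2 * r)"
    using r by (subst nn_integral_cmult_indicator) (auto simp: emeasure_ball_real)
  finally show ?thesis
    using r False assms
    by (simp add: ball_average_def emeasure_ball_real divide_le_posI_ennreal mult.commute)
qed

lemma local_maximal_le:
  assumes "0 \<le> B" and "\<And>y. \<bar>y - x\<bar> \<le> R x \<Longrightarrow> \<bar>f y\<bar> \<le> B"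
  shows "local_maximal R f x \<le> ennreal B"
  unfolding local_maximal_def
  using assms by (intro SUP_least ball_average_le) auto

text \<open>A single admissible radius r bounds the supremum from below, and of its ball only the
  part A, of measure at least m, is kept.\<close>

lemma local_maximal_ge:
  assumes r: "0 < r" "r \<le> R x" and A: "A \<in> sets lebesgue" "A \<subseteq> ball x r"
    and f: "\<And>y. y \<in> A \<Longrightarrow> b \<le> \<bar>f y\<bar>"
    and b: "0 \<le> b" and m: "ennreal m \<le> emeasure lebesgue A" "0 \<le> m"
  shows "ennreal (b * m / (2 * r)) \<le> local_maximal R f x"
proof -
  have "ennreal (b * m) \<le> ennreal b * emeasure lebesgue A"
    using b m by (simp add: ennreal_mult mult_left_mono)
  also have "\<dots> = (\<integral>\<^sup>+ y. ennreal b * indicator A y \<partial>lebesgue)"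
    using A by (subst nn_integral_cmult_indicator) auto
  also have "\<dots> \<le> (\<integral>\<^sup>+ y \<in> ball x r. ennreal \<bar>f y\<bar> \<partial>lebesgue)"
    using A f by (intro nn_integral_mono) (auto split: split_indicator intro!: ennreal_leI)
  finally have "ennreal (b * m) / ennreal (2 * r) \<le> ball_average f x r"
    using r by (simp add: ball_average_def emeasure_ball_real divide_right_mono_ennreal)
  also have "\<dots> \<le> local_maximal R f x"
    unfolding local_maximal_def using r by (intro SUP_upper) auto
  finally show ?thesis
    using r b m by (simp add: divide_ennreal)
qed

section \<open>Upper and lower bounds for the double integral of the Sobolev seminorm\<close>

text \<open>Near 0 the integrand is u^(p-1-t), integrable because t < p; beyond 1 it is u^(-1-t),
  integrable because 0 < t. It is the kernel that dominates a Lipschitz function of oscillation at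
  most 1, at unit scale.\<close>

lemma nn_integral_kernel_finite:
  fixes p t :: real
  assumes "0 < t" "t < p"
  shows "(\<integral>\<^sup>+ u. ennreal (min 1 \<bar>u\<bar> powr p / \<bar>u\<bar> powr (1 + t)) \<partial>lborel) < \<infinity>"
proof -
  define g where "g u = ennreal (u powr (p - 1 - t)) * indicator {0..1} u
      + ennreal (u powr (- 1 - t)) * indicator {1..} u" for u :: real
  have [measurable]: "g \<in> borel_measurable borel"
    unfolding g_def by measurable
  have "(\<integral>\<^sup>+ u. g u \<partial>lborel) = ennreal (1 / (p - t)) + ennreal (1 / t)"
    unfolding g_def
    using nn_integral_has_integral_lebesgue'[OF _ has_integral_powr_from_0[of "p - 1 - t" 1]]
      nn_integral_has_integral_lebesgue'[OF _ has_integral_powr_to_inf[of "- 1 - t" 1]] assms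
    by (subst nn_integral_add) auto
  then have fin: "(\<integral>\<^sup>+ u. g u \<partial>lborel) < \<infinity>" by simp
  \<comment> \<open>Evenness is handled by adding the reflection of \<open>g\<close>, written as an
    affine substitution so that \<open>nn_integral_real_affine\<close> applies.\<close>
  have "(\<integral>\<^sup>+ u. ennreal (min 1 \<bar>u\<bar> powr p / \<bar>u\<bar> powr (1 + t)) \<partial>lborel) \<le> (\<integral>\<^sup>+ u. g u + g (0 + (-1) * u) \<partial>lborel)"
  proof (intro nn_integral_mono)
    fix u :: real
    have *: "ennreal (min 1 v powr p / v powr (1 + t)) \<le> g v" if "0 \<le> v" for v
    proof (cases "v \<le> 1")
      case True
      have "v powr p / v powr (1 + t) = v powr (p - 1 - t)"
        by (simp add: powr_diff[symmetric] algebra_simps)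
      with True that show ?thesis by (auto simp: g_def indicator_def min_def)
    next
      case False
      then show ?thesis by (auto simp: g_def powr_diff powr_minus_divide powr_add min_def divide_simps)
    qed
    show "ennreal (min 1 \<bar>u\<bar> powr p / \<bar>u\<bar> powr (1 + t)) \<le> g u + g (0 + (-1) * u)"
    proof (cases "0 \<le> u")
      case True
      then show ?thesis using *[of u] by (simp add: add_increasing2)
    next
      case False
      then show ?thesis using *[of "- u"] by (simp add: add_increasing)
    qed
  qed
  also have "\<dots> = (\<integral>\<^sup>+ u. g u \<partial>lborel) + (\<integral>\<^sup>+ u. g (0 + (-1) * u) \<partial>lborel)"
    by (intro nn_integral_add) auto
  also have "(\<integral>\<^sup>+ u. g (0 + (-1) * u) \<partial>lborel) = (\<integral>\<^sup>+ u. g u \<partial>lborel)"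
    using nn_integral_real_affine[of g "-1" 0] by simp
  finally show ?thesis using fin by (simp add: order_le_less_trans)
qed

text \<open>A pair of points contributes only if one of them lies in J, which gives the factor 2 m.
  The other point then ranges over the whole line against a translation-invariant kernel, and
  rescaling that kernel by a produces a^(-t).\<close>

lemma sobolev_integral_le:
  fixes f :: "real \<Rightarrow> real"
  assumes [measurable]: "f \<in> borel_measurable borel" "J \<in> sets borel"
    and a: "0 < a" and p: "0 \<le> p" and m: "emeasure lborel J = ennreal m" "0 \<le> m"
    and f: "\<And>x y. \<bar>f x - f y\<bar> \<le> min 1 (\<bar>x - y\<bar> / a)" "\<And>x. x \<notin> J \<Longrightarrow> f x = 1"
  shows "(\<integral>\<^sup>+ x \<in> G. (\<integral>\<^sup>+ y \<in> G. ennreal (\<bar>f x - f y\<bar> powr p / \<bar>x - y\<bar> powr (1 + t)) \<partial>lebesgue) \<partial>lebesgue)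
    \<le> ennreal (2 * m * a powr (- t))
        * (\<integral>\<^sup>+ u. ennreal (min 1 \<bar>u\<bar> powr p / \<bar>u\<bar> powr (1 + t)) \<partial>lborel)"
proof -
  define \<phi> where "\<phi> u = ennreal (min 1 (\<bar>u\<bar> / a) powr p / \<bar>u\<bar> powr (1 + t))" for u
  define \<kappa> where "\<kappa> u = ennreal (min 1 \<bar>u\<bar> powr p / \<bar>u\<bar> powr (1 + t))" for u :: real
  have [measurable]: "\<phi> \<in> borel_measurable borel" "\<kappa> \<in> borel_measurable borel"
    unfolding \<phi>_def \<kappa>_def by measurable
  have scale: "\<phi> (0 + a * u) = ennreal (a powr (- 1 - t)) * \<kappa> u" for u
  proof -
    have "\<bar>a * u\<bar> / a = \<bar>u\<bar>" "\<bar>a * u\<bar> powr (1 + t) = a powr (1 + t) * \<bar>u\<bar> powr (1 + t)"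
      using a by (auto simp: abs_mult powr_mult)
    moreover have "a powr (- 1 - t) = 1 / a powr (1 + t)"
      by (metis minus_add_distrib powr_minus_divide uminus_add_conv_diff add.commute)
    ultimately show ?thesis
      by (simp add: \<phi>_def \<kappa>_def ennreal_mult[symmetric])
  qed
  have "integral\<^sup>N lborel \<phi> = ennreal a * (ennreal (a powr (- 1 - t)) * integral\<^sup>N lborel \<kappa>)"
    using a by (subst nn_integral_real_affine[of \<phi> a 0]) (simp_all only: scale, auto simp: nn_integral_cmult)
  also have "\<dots> = ennreal (a * a powr (- 1 - t)) * integral\<^sup>N lborel \<kappa>"
    using a by (simp add: ennreal_mult mult.assoc)
  also have "a * a powr (- 1 - t) = a powr (- t)"
    using a powr_add[of a 1 "- 1 - t"] by simp
  finally have \<phi>_int: "integral\<^sup>N lborel \<phi> = ennreal (a powr (- t)) * integral\<^sup>N lborel \<kappa>" .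
  have shift: "(\<integral>\<^sup>+ y. \<phi> (y - x) \<partial>lborel) = integral\<^sup>N lborel \<phi>" for x
    using nn_integral_real_affine[of \<phi> 1 "- x"] by simp
  have flip: "(\<integral>\<^sup>+ x. \<phi> (y - x) \<partial>lborel) = integral\<^sup>N lborel \<phi>" for y
    using nn_integral_real_affine[of \<phi> "-1" y] by simp
  have pointwise: "ennreal (\<bar>f x - f y\<bar> powr p / \<bar>x - y\<bar> powr (1 + t)) * indicator G y * indicator G x
      \<le> indicator J x * \<phi> (y - x) + indicator J y * \<phi> (y - x)" for x y
  proof -
    have "\<bar>f x - f y\<bar> powr p / \<bar>x - y\<bar> powr (1 + t) \<le> min 1 (\<bar>y - x\<bar> / a) powr p / \<bar>y - x\<bar> powr (1 + t)"
      using f(1)[of x y] p by (auto simp: abs_minus_commute intro!: divide_right_mono powr_mono2)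
    then have "ennreal (\<bar>f x - f y\<bar> powr p / \<bar>x - y\<bar> powr (1 + t)) \<le> \<phi> (y - x)"
      unfolding \<phi>_def by (rule ennreal_leI)
    moreover have "ennreal (\<bar>f x - f y\<bar> powr p / \<bar>x - y\<bar> powr (1 + t)) = 0" if "x \<notin> J" "y \<notin> J"
      using f(2) that by simp
    ultimately show ?thesis
      by (auto split: split_indicator intro: add_increasing2)
  qed
  have "(\<integral>\<^sup>+ x \<in> G. (\<integral>\<^sup>+ y \<in> G. ennreal (\<bar>f x - f y\<bar> powr p / \<bar>x - y\<bar> powr (1 + t)) \<partial>lebesgue) \<partial>lebesgue)
      \<le> (\<integral>\<^sup>+ x. (\<integral>\<^sup>+ y. indicator J x * \<phi> (y - x) + indicator J y * \<phi> (y - x) \<partial>lborel) \<partial>lborel)"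
    \<comment> \<open>Passing to \<open>lborel\<close> prepares for Fubini, which is applied only to
      the Borel majorant.\<close>
    unfolding nn_integral_completion
  proof (intro nn_integral_mono)
    fix x
    show "(\<integral>\<^sup>+ y \<in> G. ennreal (\<bar>f x - f y\<bar> powr p / \<bar>x - y\<bar> powr (1 + t)) \<partial>lborel) * indicator G x
      \<le> (\<integral>\<^sup>+ y. indicator J x * \<phi> (y - x) + indicator J y * \<phi> (y - x) \<partial>lborel)"
    proof (cases "x \<in> G")
      case True
      then show ?thesis
        using pointwise[of x] by (auto intro!: nn_integral_mono)
    qed simp
  qed
  also have "\<dots> = (\<integral>\<^sup>+ x. (\<integral>\<^sup>+ y. indicator J x * \<phi> (y - x) \<partial>lborel) \<partial>lborel)
      + (\<integral>\<^sup>+ x. (\<integral>\<^sup>+ y. indicator J y * \<phi> (y - x) \<partial>lborel) \<partial>lborel)"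
    by (simp add: nn_integral_add)
  also have "(\<integral>\<^sup>+ x. (\<integral>\<^sup>+ y. indicator J x * \<phi> (y - x) \<partial>lborel) \<partial>lborel) = ennreal m * integral\<^sup>N lborel \<phi>"
    using m by (simp add: nn_integral_cmult nn_integral_multc shift)
  \<comment> \<open>After the exchange the indicator of J is constant in the inner variable, as in
    the first summand.\<close>
  also have "(\<integral>\<^sup>+ x. (\<integral>\<^sup>+ y. indicator J y * \<phi> (y - x) \<partial>lborel) \<partial>lborel)
      = (\<integral>\<^sup>+ y. (\<integral>\<^sup>+ x. indicator J y * \<phi> (y - x) \<partial>lborel) \<partial>lborel)"
    by (intro lborel_pair.Fubini'[symmetric]) measurable
  also have "\<dots> = ennreal m * integral\<^sup>N lborel \<phi>"
    using m by (simp add: nn_integral_cmult nn_integral_multc flip)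
  also have "ennreal m * integral\<^sup>N lborel \<phi> + ennreal m * integral\<^sup>N lborel \<phi>
      = ennreal (2 * m) * integral\<^sup>N lborel \<phi>"
    using m(2) by (simp add: distrib_right[symmetric] ennreal_plus[symmetric] del: ennreal_plus)
  also have "\<dots> = ennreal (2 * m * a powr (- t)) * integral\<^sup>N lborel \<kappa>"
    using m(2) by (simp add: \<phi>_int ennreal_mult mult.assoc)
  finally show ?thesis unfolding \<kappa>_def .
qed

text \<open>Only x in A and y in a set S depending on x are kept. The bound compares the integrand
  with indicators of measurable sets and uses monotonicity alone, so it applies to the maximal
  function without a proof that this function is measurable.\<close>

lemma sobolev_integral_ge:
  fixes g :: "real \<Rightarrow> real"
  assumes A: "A \<in> sets lebesgue" "A \<subseteq> G" "ennreal l \<le> emeasure lebesgue A" "0 \<le> l"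
    and pos: "0 < \<eta>" "0 \<le> p" "0 \<le> t" "0 \<le> m"
    and S: "\<And>x. x \<in> A \<Longrightarrow> \<exists>S\<in>sets lebesgue. S \<subseteq> G \<and> ennreal m \<le> emeasure lebesgue S \<and>
      (\<forall>y\<in>S. \<eta> \<le> \<bar>g x - g y\<bar> \<and> \<bar>x - y\<bar> \<le> e)"
  shows "ennreal (l * (m * (\<eta> powr p / e powr (1 + t))))
    \<le> (\<integral>\<^sup>+ x \<in> G. (\<integral>\<^sup>+ y \<in> G. ennreal (\<bar>g x - g y\<bar> powr p / \<bar>x - y\<bar> powr (1 + t)) \<partial>lebesgue) \<partial>lebesgue)"
proof -
  let ?b = "\<eta> powr p / e powr (1 + t)"
  have inner: "ennreal (m * ?b) \<le> (\<integral>\<^sup>+ y \<in> G. ennreal (\<bar>g x - g y\<bar> powr p / \<bar>x - y\<bar> powr (1 + t)) \<partial>lebesgue)"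
    if "x \<in> A" for x
  proof -
    obtain S where S: "S \<in> sets lebesgue" "S \<subseteq> G" "ennreal m \<le> emeasure lebesgue S"
      "\<And>y. y \<in> S \<Longrightarrow> \<eta> \<le> \<bar>g x - g y\<bar> \<and> \<bar>x - y\<bar> \<le> e"
      using S[OF \<open>x \<in> A\<close>] by blast
    have *: "?b \<le> \<bar>g x - g y\<bar> powr p / \<bar>x - y\<bar> powr (1 + t)" if "y \<in> S" for y
    proof -
      \<comment> \<open>The denominator must be positive for \<open>frac_le\<close>; the gap \<eta>
        > 0 excludes the diagonal.\<close>
      have "x \<noteq> y" using S(4)[OF that] pos by auto
      with S(4)[OF that] pos show ?thesis
        by (auto intro!: frac_le powr_mono2)
    qed
    have "ennreal (m * ?b) \<le> ennreal ?b * emeasure lebesgue S"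
      using S(3) pos by (subst mult.commute) (auto simp: ennreal_mult intro!: mult_left_mono simp del: times_divide_eq_left)
    also have "\<dots> = (\<integral>\<^sup>+ y. ennreal ?b * indicator S y \<partial>lebesgue)"
      using S(1) by (subst nn_integral_cmult_indicator) auto
    also have "\<dots> \<le> (\<integral>\<^sup>+ y \<in> G. ennreal (\<bar>g x - g y\<bar> powr p / \<bar>x - y\<bar> powr (1 + t)) \<partial>lebesgue)"
      using S(2) * by (intro nn_integral_mono) (auto split: split_indicator intro!: ennreal_leI)
    finally show ?thesis .
  qed
  have "ennreal (l * (m * ?b)) \<le> ennreal (m * ?b) * emeasure lebesgue A"
    using A(3,4) pos by (subst mult.commute) (auto simp: ennreal_mult intro!: mult_left_mono simp del: times_divide_eq_left times_divide_eq_right)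
  also have "\<dots> = (\<integral>\<^sup>+ x. ennreal (m * ?b) * indicator A x \<partial>lebesgue)"
    using A(1) by (subst nn_integral_cmult_indicator) auto
  also have "\<dots> \<le> (\<integral>\<^sup>+ x \<in> G. (\<integral>\<^sup>+ y \<in> G. ennreal (\<bar>g x - g y\<bar> powr p / \<bar>x - y\<bar> powr (1 + t)) \<partial>lebesgue) \<partial>lebesgue)"
    using A(2) inner by (intro nn_integral_mono) (auto split: split_indicator)
  finally show ?thesis .
qed

section \<open>The multiscale grid and the distance to it\<close>

text \<open>
  The meshes 2^(-kM) are nested, so only the coarsest grid that applies at z, that is the least k
  with 2^(-k) at most z, imposes a condition.
\<close>

definition grid_set :: "nat \<Rightarrow> real set" where
  "grid_set M = {z. \<forall>k::nat. z < 1 \<and> (1/2) ^ k \<le> z \<longrightarrow> z * 2 ^ (k * M) \<in> \<int>}"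

text \<open>Round x down to the mesh 2^(-kM). The endpoint 2^(-k) is itself a multiple of the mesh,
  so rounding does not fall below it.\<close>

lemma grid_set_floor:
  fixes x :: real
  assumes M: "1 \<le> M" and x: "(1/2) ^ k \<le> x" "x < 1"
    and min: "\<And>k'. (1/2) ^ k' \<le> x \<Longrightarrow> k \<le> k'"
  obtains z where "z \<in> grid_set M" "z * 2 ^ (k * M) \<in> \<int>" "(1/2) ^ k \<le> z" "z \<le> x" "x < z + (1/2) ^ (k * M)"
proof
  define N :: real where "N = 2 ^ (k * M)"
  define z where "z = of_int \<lfloor>x * N\<rfloor> / N"
  have N: "N > 0" by (simp add: N_def)
  show "z \<le> x" using N by (simp add: z_def pos_divide_le_eq)
  have "x * N < of_int \<lfloor>x * N\<rfloor> + 1" by linarith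
  then show "x < z + (1/2) ^ (k * M)"
    using N by (simp add: z_def power_one_over pos_less_divide_eq flip: N_def add_divide_distrib)
  have "z * N = of_int \<lfloor>x * N\<rfloor>" using N by (simp add: z_def)
  then have zN: "z * N \<in> \<int>" by simp
  then show "z * 2 ^ (k * M) \<in> \<int>" by (simp add: N_def)
  have "k \<le> k * M" using M by simp
  then have "N = 2 ^ k * 2 ^ (k * M - k)"
    by (simp add: N_def flip: power_add)
  then have "(1/2) ^ k * N = of_int (2 ^ (k * M - k))"
    by (simp add: power_one_over)
  moreover have "(1/2) ^ k * N \<le> x * N" using x N by simp
  ultimately have "(1/2) ^ k * N \<le> of_int \<lfloor>x * N\<rfloor>"
    by (metis floor_mono floor_of_int of_int_le_iff)
  then show "(1/2) ^ k \<le> z" using N by (simp add: z_def pos_le_divide_eq)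
  show "z \<in> grid_set M"
    unfolding grid_set_def
  proof safe
    fix k' :: nat
    assume "(1/2) ^ k' \<le> z"
    \<comment> \<open>Levels coarser than k do not apply at z because z \<le> x; at finer levels the
      mesh divides that of level k.\<close>
    with \<open>z \<le> x\<close> have "k \<le> k'" by (intro min) simp
    then have "k * M \<le> k' * M" by simp
    then have "(2::real) ^ (k' * M) = N * of_int (2 ^ (k' * M - k * M))"
      by (simp add: N_def flip: power_add)
    then show "z * 2 ^ (k' * M) \<in> \<int>"
      using zN by (metis Ints_mult Ints_of_int mult.assoc)
  qed
qed

lemma infdist_le_gap:
  fixes x :: real
  assumes "z \<in> Z" "z \<le> x"
  shows "infdist x Z \<le> x - z"
  using infdist_le[OF assms(1), of x] assms(2) by (simp add: dist_real_def)

lemma le_infdistI: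
  fixes x :: real
  assumes "Z \<noteq> {}" "\<And>w. w \<in> Z \<Longrightarrow> d \<le> \<bar>x - w\<bar>"
  shows "d \<le> infdist x Z"
  using assms by (simp add: infdist_notempty dist_real_def cINF_greatest)

text \<open>At the least level k with 2^(-k) \<le> x, the gap to the grid is at most the mesh
  2^(-kM), whose M-th root is 2^(-k). Points from 1 on belong to the grid vacuously. Together the
  two claims keep the radius below the distance to the endpoints of (0,2).\<close>

lemma infdist_grid_set_le:
  assumes M: "1 \<le> M" and x: "0 < x"
  shows "infdist x (grid_set M) powr (1 / real M) \<le> x"
    and "1 \<le> x \<Longrightarrow> infdist x (grid_set M) = 0"
proof -
  show zero: "infdist x (grid_set M) = 0" if "1 \<le> x"
    using that by (simp add: grid_set_def)
  show "infdist x (grid_set M) powr (1 / real M) \<le> x"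
  proof (cases "x < 1")
    case True
    define k where "k = (LEAST k. (1/2) ^ k \<le> x)"
    obtain n where "(1/2) ^ n \<le> x"
      using real_arch_pow_inv[OF x, of "1/2"] by (auto intro: less_imp_le)
    then have k: "(1/2) ^ k \<le> x" unfolding k_def by (rule LeastI)
    obtain z where z: "z \<in> grid_set M" "z \<le> x" "x < z + (1/2) ^ (k * M)"
      using grid_set_floor[OF M k True] by (metis Least_le k_def)
    have "infdist x (grid_set M) \<le> (1/2) ^ (k * M)"
      using infdist_le_gap[OF z(1,2)] z(3) by simp
    then have "infdist x (grid_set M) powr (1 / real M) \<le> ((1/2) ^ (k * M)) powr (1 / real M)"
      by (intro powr_mono2) (auto simp: infdist_nonneg)
    also have "\<dots> = (1/2) ^ k"
      using M by (simp add: powr_powr flip: powr_realpow)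
    finally show ?thesis using k by simp
  next
    case False
    with x zero show ?thesis by simp
  qed
qed

text \<open>No grid point lies strictly between z and z + e: those from 1 on are to the right of the
  cell, those below 2^(-k) to its left, and all others are multiples of e, even if a coarser level
  also applies to them. The middle half of the cell is thus e/4 away from the grid.\<close>

lemma infdist_grid_set_ge:
  fixes z y :: real and k M :: nat
  defines "e \<equiv> (1/2) ^ (k * M)"
  assumes z: "z * 2 ^ (k * M) \<in> \<int>" "(1/2) ^ k \<le> z" "z + e \<le> 1"
    and y: "z + e / 4 \<le> y" "y \<le> z + 3 * e / 4"
  shows "e / 4 \<le> infdist y (grid_set M)"
proof -
  have e: "e > 0" by (simp add: e_def)
  have "e / 4 \<le> \<bar>y - w\<bar>" if "w \<in> grid_set M" for w
  proof -
    consider "1 \<le> w" | "w < (1/2) ^ k" | "w < 1" "(1/2) ^ k \<le> w" by linarith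
    then show ?thesis
    proof cases
      case 3
      with that have "w * 2 ^ (k * M) \<in> \<int>" by (simp add: grid_set_def)
      then obtain m n where mn: "w * 2 ^ (k * M) = of_int m" "z * 2 ^ (k * M) = of_int n"
        using z(1) by (auto elim!: Ints_cases)
      have eN: "e * 2 ^ (k * M) = 1" by (simp add: e_def power_one_over)
      have w: "w = e * of_int m" and z: "z = e * of_int n"
        using eN mn by (metis mult.assoc mult.commute mult_1)+
      have "m \<le> n \<or> n + 1 \<le> m" by linarith
      then have "w \<le> z \<or> z + e \<le> w"
      proof
        assume "n + 1 \<le> m"
        then have "real_of_int n + 1 \<le> real_of_int m" by linarith
        then have "e * (real_of_int n + 1) \<le> e * real_of_int m" using e by (intro mult_left_mono) auto
        then show ?thesis by (simp add: w z algebra_simps)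
      qed (use e in \<open>simp add: w z\<close>)
      with y show ?thesis by linarith
    qed (use z y e in linarith)+
  qed
  moreover have "1 \<in> grid_set M" by (simp add: grid_set_def)
  ultimately show ?thesis
    by (intro le_infdistI) auto
qed

section \<open>The maximal function of the test function\<close>

text \<open>If the radius is at most h/32, all balls stay within h/16 of c, where f \<le> 1/4. If it
  is at least h/2, the ball of radius h/2 has length h, and f = 1 on it outside a middle piece of
  length h/2, so the average is at least 1/2.\<close>

lemma local_maximal_capped_distance:
  fixes M k :: nat and c h x :: real
  defines "h \<equiv> (1/2) ^ k"
  defines "R \<equiv> \<lambda>x. infdist x (grid_set M) powr (1 / real M)"
  defines "f \<equiv> \<lambda>x. min 1 (4 * \<bar>x - c\<bar> / h)"
  assumes M: "2 \<le> M" and x: "\<bar>x - c\<bar> \<le> h / 32"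
  shows "infdist x (grid_set M) \<le> (1/32) ^ M * (1/2) ^ (k * M) \<Longrightarrow> enn2real (local_maximal R f x) \<le> 1/4"
    and "(1/2) ^ (k * M) / 4 \<le> infdist x (grid_set M) \<Longrightarrow> 1/2 \<le> enn2real (local_maximal R f x)"
proof -
  have h: "h > 0" by (simp add: h_def)
  have root: "(a ^ M) powr (1 / real M) = a" if "a > 0" for a :: real
    using M that by (simp add: powr_powr flip: powr_realpow)
  have hM: "(1/2) ^ (k * M) = h ^ M" by (simp add: h_def power_mult)
  have f_nonneg: "0 \<le> f y" for y using h by (simp add: f_def)
  \<comment> \<open>\<open>enn2real\<close> sends \<infinity> to 0, so the lower bound 1/2 survives
    the conversion only because the supremum is finite.\<close>
  have fin: "local_maximal R f x \<le> ennreal 1"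
    using f_nonneg by (intro local_maximal_le) (auto simp: f_def)
  show "enn2real (local_maximal R f x) \<le> 1/4" if "infdist x (grid_set M) \<le> (1/32) ^ M * (1/2) ^ (k * M)"
  proof -
    have "(1/32) ^ M * (1/2) ^ (k * M) = (h / 32) ^ M"
      unfolding hM by (simp add: power_divide)
    then have "R x \<le> ((h / 32) ^ M) powr (1 / real M)"
      unfolding R_def using that by (intro powr_mono2) (auto simp: infdist_nonneg)
    then have Rx: "R x \<le> h / 32" using root[of "h / 32"] h by simp
    have "local_maximal R f x \<le> ennreal (1/4)"
    proof (intro local_maximal_le)
      fix y assume "\<bar>y - x\<bar> \<le> R x"
      with Rx x have "\<bar>y - c\<bar> \<le> h / 16" by linarith
      then have "f y \<le> 1/4" using h by (simp add: f_def field_simps min_le_iff_disj)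
      with f_nonneg[of y] show "\<bar>f y\<bar> \<le> 1/4" by simp
    qed simp
    from enn2real_mono[OF this] show ?thesis by simp
  qed
  show "1/2 \<le> enn2real (local_maximal R f x)" if "(1/2) ^ (k * M) / 4 \<le> infdist x (grid_set M)"
  proof -
    \<comment> \<open>M \<ge> 2 makes (h/2)^M at most h^M / 4, so a quarter of the mesh already
      yields a radius of at least h/2.\<close>
    have "(1/2 :: real) ^ M \<le> (1/2) ^ 2" using M by (intro power_decreasing) auto
    then have "h ^ M * (1/2) ^ M \<le> h ^ M * (1/4)"
      using h by (intro mult_left_mono) (auto simp: power2_eq_square)
    also have "h ^ M * (1/2) ^ M = (h / 2) ^ M"
      by (simp add: power_divide)
    finally have "(h / 2) ^ M \<le> infdist x (grid_set M)"
      using that unfolding hM by linarith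
    then have "((h / 2) ^ M) powr (1 / real M) \<le> R x"
      unfolding R_def using h by (intro powr_mono2) auto
    then have Rx: "h / 2 \<le> R x" using root[of "h / 2"] h by simp
    \<comment> \<open>The ball of radius h/2 around x without the closed interval of radius h/4
      around c; its measure is h/2 wherever x lies near c.\<close>
    let ?A = "{x - h/2<..<c - h/4} \<union> {c + h/4<..<x + h/2}"
    have "ennreal (1 * (h / 2) / (2 * (h / 2))) \<le> local_maximal R f x"
    proof (rule local_maximal_ge)
      have "x - h / 2 \<le> c + h / 4" "c - h / 4 \<le> x + h / 2" using x h by linarith+
      then show "?A \<subseteq> ball x (h / 2)" by (auto simp: ball_eq_greaterThanLessThan)
      show "1 \<le> \<bar>f y\<bar>" if "y \<in> ?A" for y
      proof -
        have "y \<le> c - h / 4 \<or> c + h / 4 \<le> y" using that by auto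
        then have "h / 4 \<le> \<bar>y - c\<bar>" by linarith
        then show ?thesis using h by (simp add: f_def field_simps)
      qed
      have "emeasure lborel ?A = emeasure lborel {x - h/2<..<c - h/4} + emeasure lborel {c + h/4<..<x + h/2}"
        using h by (intro plus_emeasure[symmetric]) auto
      also have "\<dots> = ennreal (c - h/4 - (x - h/2)) + ennreal (x + h/2 - (c + h/4))"
      proof -
        have "x - h/2 \<le> c - h/4" "c + h/4 \<le> x + h/2" using x h by linarith+
        then show ?thesis by (simp only: emeasure_lborel_Ioo)
      qed
      also have "\<dots> = ennreal (c - h/4 - (x - h/2) + (x + h/2 - (c + h/4)))"
        using x h by (intro ennreal_plus[symmetric]) linarith+
      also have "c - h/4 - (x - h/2) + (x + h/2 - (c + h/4)) = h / 2" by simp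
      finally show "ennreal (h / 2) \<le> emeasure lebesgue ?A" by simp
    qed (use Rx h in auto)
    then have "ennreal (1/2) \<le> local_maximal R f x" using h by simp
    moreover have "local_maximal R f x < top" using fin by (rule order_le_less_trans) simp
    ultimately have "enn2real (ennreal (1/2)) \<le> enn2real (local_maximal R f x)" by (rule enn2real_mono)
    moreover have "enn2real (ennreal (1/2)) = 1/2" by (rule enn2real_ennreal) simp
    ultimately show ?thesis by simp
  qed
qed

lemma bounded_mem_Lp_on:
  assumes "f \<in> borel_measurable borel" "G \<in> sets borel" "emeasure lborel G < \<infinity>"
    and "\<And>x. \<bar>f x\<bar> \<le> 1" "0 \<le> p"
  shows "f \<in> Lp_on p G"
proof -
  have [measurable]: "f \<in> borel_measurable (lebesgue_on G)"
    using assms(1) by (intro measurable_restrict_space1 measurable_completion) simp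
  interpret finite_measure "lebesgue_on G"
    using assms(2,3) by (intro finite_measureI) (auto simp: emeasure_restrict_space space_restrict_space less_top)
  have "integrable (lebesgue_on G) (\<lambda>x. \<bar>f x\<bar> powr p)"
    using assms(4,5) by (intro integrable_const_bound[where B = 1]) (auto intro!: powr_le1)
  then show ?thesis by (simp add: Lp_on_def)
qed

text \<open>In the cell of x the maximal function is at most 1/4 on a piece next to the grid point z
  and at least 1/2 on the middle half. Whatever its value at x, comparison with the midway value 3/8
  shows that it differs by at least 1/8 from all values on one of the two pieces.\<close>

lemma local_maximal_oscillation:
  fixes M k :: nat and x :: real
  defines "h \<equiv> (1/2) ^ k" and "e \<equiv> (1/2) ^ (k * M)"
  defines "g \<equiv> \<lambda>x. enn2real (local_maximal (\<lambda>x. infdist x (grid_set M) powr (1 / real M))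
      (\<lambda>x. min 1 (4 * \<bar>x - 3 * h / 2\<bar> / h)) x)"
  assumes M: "2 \<le> M" and k: "6 \<le> k" and x: "\<bar>x - 3 * h / 2\<bar> \<le> h / 64"
  shows "\<exists>S\<in>sets lebesgue. S \<subseteq> {0<..<2} \<and> ennreal ((1/32) ^ M * e) \<le> emeasure lebesgue S \<and>
      (\<forall>y\<in>S. 1/8 \<le> \<bar>g x - g y\<bar> \<and> \<bar>x - y\<bar> \<le> e)"
proof -
  have h: "0 < h" and e: "0 < e" by (simp_all add: h_def e_def)
  have h1: "h \<le> 1/64"
    using power_decreasing[OF k, of "1/2::real"] by (simp add: h_def power_one_over)
  \<comment> \<open>With k \<ge> 6 and M \<ge> 2 a cell is no longer than h/64, so the whole cell of
    x stays within h/32 of the midpoint.\<close>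
  have "k + 6 \<le> k * 2" using k by simp
  also have "\<dots> \<le> k * M" using M by (intro mult_left_mono) auto
  finally have "e \<le> (1/2) ^ (k + 6)"
    unfolding e_def by (intro power_decreasing) auto
  then have eh: "e \<le> h / 64" by (simp add: h_def power_add power_one_over)
  have "(1/32 :: real) ^ M \<le> (1/32) ^ 1" using M by (intro power_decreasing) auto
  then have l: "(1/32) ^ M * e \<le> e / 2" using e by simp
  \<comment> \<open>x lies below 2h, so k is the least level that applies at x.\<close>
  have min: "k \<le> k'" if "(1/2) ^ k' \<le> x" for k' :: nat
  proof (rule ccontr)
    assume "\<not> k \<le> k'"
    then have "Suc k' \<le> k" by simp
    then have "h \<le> (1/2) ^ Suc k'" unfolding h_def by (intro power_decreasing) auto
    with that x h show False by simp
  qed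
  have "1 \<le> M" "(1/2) ^ k \<le> x" "x < 1"
    using M x h h1 unfolding h_def[symmetric] by linarith+
  from grid_set_floor[OF this min]
  obtain z where z: "z \<in> grid_set M" "z * 2 ^ (k * M) \<in> \<int>" "h \<le> z" "z \<le> x" "x < z + e"
    unfolding h_def e_def by metis
  \<comment> \<open>Chosen so that its M-th root is h/32, the radius allowed in the low case; being
    at most e/2, it also bounds the length of the middle half from below.\<close>
  let ?l = "(1/32) ^ M * e"
  have near: "\<bar>y - 3 * h / 2\<bar> \<le> h / 32" if "z \<le> y" "y \<le> z + e" for y
    using that x z eh by linarith
  have low: "g y \<le> 1/4" if "y \<in> {z..z + ?l}" for y
    unfolding g_def h_def
  proof (rule local_maximal_capped_distance(1)[OF M])
    show "\<bar>y - 3 * (1/2) ^ k / 2\<bar> \<le> (1/2) ^ k / 32"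
    proof -
      have "z \<le> y" "y \<le> z + ?l" using that by simp_all
      with l e have "y \<le> z + e" by linarith
      with near \<open>z \<le> y\<close> show ?thesis unfolding h_def by blast
    qed
    show "infdist y (grid_set M) \<le> (1/32) ^ M * (1/2) ^ (k * M)"
      using infdist_le_gap[OF z(1), of y] that by (simp add: e_def)
  qed
  have high: "1/2 \<le> g y" if "y \<in> {z + e/4..z + 3*e/4}" for y
    unfolding g_def h_def
  proof (rule local_maximal_capped_distance(2)[OF M])
    show "\<bar>y - 3 * (1/2) ^ k / 2\<bar> \<le> (1/2) ^ k / 32"
      using near[of y] that e unfolding h_def by auto
    show "(1/2) ^ (k * M) / 4 \<le> infdist y (grid_set M)"
    proof -
      have "z + e \<le> 1" using z x h h1 eh by linarith
      then show ?thesis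
        using infdist_grid_set_ge[of z k M y] that z(2,3) by (simp add: e_def h_def)
    qed
  qed
  have "0 < z" "z + e < 2" using z x h h1 eh by linarith+
  then have sub: "{z..z + e} \<subseteq> {0<..<2}" by auto
  show ?thesis
  proof (cases "3/8 \<le> g x")
    case True
    have "1/8 \<le> \<bar>g x - g y\<bar> \<and> \<bar>x - y\<bar> \<le> e" if "y \<in> {z..z + ?l}" for y
    proof -
      have "z \<le> y" "y \<le> z + ?l" using that by simp_all
      with low[OF that] True l e z(4,5) show ?thesis by linarith
    qed
    moreover have "z + ?l \<le> z + e" using l e by linarith
    then have "{z..z + ?l} \<subseteq> {0<..<2}" using sub by (meson atLeastatMost_subset_iff order_refl subset_trans)
    moreover have "ennreal ?l \<le> emeasure lebesgue {z..z + ?l}" using e by simp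
    ultimately show ?thesis by (meson fmeasurableD lmeasurable_interval(1))
  next
    case False
    have "1/8 \<le> \<bar>g x - g y\<bar> \<and> \<bar>x - y\<bar> \<le> e" if "y \<in> {z + e/4..z + 3*e/4}" for y
    proof -
      have "z + e/4 \<le> y" "y \<le> z + 3*e/4" using that by simp_all
      with high[OF that] False e z(4,5) show ?thesis by linarith
    qed
    moreover have "z \<le> z + e/4" "z + 3*e/4 \<le> z + e" using e by linarith+
    then have "{z + e/4..z + 3*e/4} \<subseteq> {0<..<2}" using sub by (meson atLeastatMost_subset_iff subset_trans)
    moreover have "emeasure lebesgue {z + e/4..z + 3*e/4} = ennreal (z + 3*e/4 - (z + e/4))"
      using e by (simp add: emeasure_lborel_Icc_eq)
    moreover have "ennreal ?l \<le> ennreal (z + 3*e/4 - (z + e/4))"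
      using l by (intro ennreal_leI) linarith
    ultimately show ?thesis by (metis fmeasurableD lmeasurable_interval(1))
  qed
qed

section \<open>Comparison of the two energies as the scale tends to 0\<close>

theorem lemma5p7:
  fixes M :: nat and \<alpha> s p :: real
  assumes "M \<ge> 2" and "\<alpha> = 1 / real M"
    and "0 < s" and "s < 1" and "1 < p"
    and "\<alpha> * s * p \<ge> 1"
  shows "\<exists>(G :: real set) (R :: real \<Rightarrow> real).
           open G \<and> bounded G \<and> holder_on \<alpha> G R \<and>
           (\<forall>x\<in>G. 0 \<le> R x \<and> R x \<le> infdist x (frontier G)) \<and>
           (\<forall>\<sigma>\<in>{\<alpha> * s<..<1}.
              \<not> (\<exists>C::real. C > 0 \<and>
                   (\<forall>f\<in>Lp_on p G.
                      sobolev_seminorm \<sigma> p G (\<lambda>x. enn2real (local_maximal R f x))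
                        \<le> ennreal C * sobolev_seminorm s p G f)))"
proof -
  define G where "G = {0<..<2::real}"
  define R where "R = (\<lambda>x. infdist x (grid_set M) powr (1 / real M))"
  have M: "2 \<le> M" and \<alpha>: "\<alpha> = 1 / real M" using assms by auto
  have "open G" "bounded G" by (auto simp: G_def)
  have holder: "holder_on \<alpha> G R"
    unfolding R_def \<alpha> using M by (intro holder_on_infdist_powr) auto
  have R_le: "0 \<le> R x \<and> R x \<le> infdist x (frontier G)" if "x \<in> G" for x
  proof -
    have x: "0 < x" "x < 2" using that by (auto simp: G_def)
    have fr: "frontier G = {0, 2}" by (auto simp: G_def frontier_def)
    have "R x \<le> x" using infdist_grid_set_le(1)[of M x] M x by (simp add: R_def)
    \<comment> \<open>Left of 1 the bound x is already below 2 - x; from 1 on the radius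
      vanishes.\<close>
    moreover have "R x \<le> 2 - x"
      using \<open>R x \<le> x\<close> infdist_grid_set_le(2)[of M x] M x by (cases "1 \<le> x") (auto simp: R_def)
    ultimately have "R x \<le> infdist x {0, 2}"
      using x by (intro le_infdistI) auto
    then show ?thesis by (simp add: fr R_def)
  qed
  have unbounded: False
    if \<sigma>: "\<sigma> \<in> {\<alpha> * s<..<1}" and C: "C > 0"
      and bound: "\<And>f. f \<in> Lp_on p G \<Longrightarrow> sobolev_seminorm \<sigma> p G (\<lambda>x. enn2real (local_maximal R f x))
        \<le> ennreal C * sobolev_seminorm s p G f" for \<sigma> C
  proof -
    define K where "K = enn2real (\<integral>\<^sup>+ u. ennreal (min 1 \<bar>u\<bar> powr p / \<bar>u\<bar> powr (1 + s * p)) \<partial>lborel)"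
    have K: "(\<integral>\<^sup>+ u. ennreal (min 1 \<bar>u\<bar> powr p / \<bar>u\<bar> powr (1 + s * p)) \<partial>lborel) = ennreal K" "0 \<le> K"
      using nn_integral_kernel_finite[of "s * p" p] assms by (auto simp: K_def)
    have "0 < \<alpha> * s" using assms by simp
    then have "0 < \<sigma>" using \<sigma> by simp
    \<comment> \<open>The exponent left over when h^(-sp) is divided by (h^M)^(-\<sigma>p); it is
      positive because \<sigma> > s/M.\<close>
    define q where "q = (real M * \<sigma> - s) * p"
    have q: "0 < q" using \<sigma> assms by (auto simp: q_def field_simps)
    \<comment> \<open>The parts of the two energy bounds that do not depend on k, after a common
      factor h is removed. In \<open>c1\<close>: the interval of length h/32, the relative measure
      of the sets S, and the jump 1/8. In \<open>c2\<close>: the Lipschitz scale h/4 and the kernel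
      integral.\<close>
    define c1 where "c1 = (1/32) * ((1/32) ^ M * (1/8) powr p)"
    define c2 where "c2 = C powr p * ((1/4) powr (- (s * p)) * K)"
    have c1: "0 < c1" by (simp add: c1_def)
    have key: "c1 \<le> c2 * ((1/2) powr q) ^ k" if k: "6 \<le> k" for k
    proof -
      define h :: real where "h = (1/2) ^ k"
      define e :: real where "e = (1/2) ^ (k * M)"
      define f where "f = (\<lambda>x. min 1 (4 * \<bar>x - 3 * h / 2\<bar> / h))"
      define g where "g = (\<lambda>x. enn2real (local_maximal R f x))"
      define A where "A = (\<integral>\<^sup>+ x \<in> G. (\<integral>\<^sup>+ y \<in> G. ennreal (\<bar>g x - g y\<bar> powr p / \<bar>x - y\<bar> powr (1 + \<sigma> * p)) \<partial>lebesgue) \<partial>lebesgue)"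
      define B where "B = (\<integral>\<^sup>+ x \<in> G. (\<integral>\<^sup>+ y \<in> G. ennreal (\<bar>f x - f y\<bar> powr p / \<bar>x - y\<bar> powr (1 + s * p)) \<partial>lebesgue) \<partial>lebesgue)"
      define a where "a = h / 32 * ((1/32) ^ M * e * ((1/8) powr p / e powr (1 + \<sigma> * p)))"
      define b where "b = 2 * (h / 2) * (h / 4) powr (- (s * p)) * K"
      have h: "0 < h" "0 < e" by (simp_all add: h_def e_def)
      have h1: "h \<le> 1/64"
        using power_decreasing[OF k, of "1/2::real"] by (simp add: h_def power_one_over)
      have f_meas: "f \<in> borel_measurable borel" unfolding f_def by measurable
      have f_Lp: "f \<in> Lp_on p G"
        using f_meas assms h by (intro bounded_mem_Lp_on) (auto simp: G_def f_def)
      have "ennreal a \<le> A"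
        unfolding A_def a_def
      proof (rule sobolev_integral_ge[where A = "{3*h/2 - h/64..3*h/2 + h/64}"])
        fix x assume "x \<in> {3*h/2 - h/64..3*h/2 + h/64}"
        then have "3 * h / 2 - h / 64 \<le> x" "x \<le> 3 * h / 2 + h / 64" by simp_all
        then have x: "\<bar>x - 3 * h / 2\<bar> \<le> h / 64" by linarith
        show "\<exists>S\<in>sets lebesgue. S \<subseteq> G \<and> ennreal ((1/32) ^ M * e) \<le> emeasure lebesgue S \<and>
            (\<forall>y\<in>S. 1/8 \<le> \<bar>g x - g y\<bar> \<and> \<bar>x - y\<bar> \<le> e)"
          unfolding G_def g_def R_def f_def e_def h_def
          by (rule local_maximal_oscillation[OF M k x[unfolded h_def]])
      qed (use h h1 \<open>0 < \<sigma>\<close> assms in \<open>auto simp: G_def\<close>)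
      moreover have "B \<le> ennreal b"
      proof -
        have "B \<le> ennreal (2 * (h / 2) * (h / 4) powr (- (s * p))) * ennreal K"
          unfolding B_def K(1)[symmetric]
        \<comment> \<open>f equals 1 from distance h/4 on, so J has measure h/2; the slope 4/h makes
          h/4 the scale a.\<close>
        proof (rule sobolev_integral_le[where J = "{3*h/2 - h/4..3*h/2 + h/4}"])
          show "\<bar>f x - f y\<bar> \<le> min 1 (\<bar>x - y\<bar> / (h / 4))" for x y
          proof -
            have "\<bar>4 * \<bar>x - 3 * h / 2\<bar> / h - 4 * \<bar>y - 3 * h / 2\<bar> / h\<bar> \<le> 4 * \<bar>x - y\<bar> / h"
              using h by (simp add: abs_if field_simps)
            moreover have "0 \<le> 4 * \<bar>x - 3 * h / 2\<bar> / h" "0 \<le> 4 * \<bar>y - 3 * h / 2\<bar> / h" using h by auto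
            moreover have "\<bar>x - y\<bar> / (h / 4) = 4 * \<bar>x - y\<bar> / h" by simp
            moreover have "\<bar>min 1 a - min 1 b\<bar> \<le> min 1 d" if "\<bar>a - b\<bar> \<le> d" "0 \<le> a" "0 \<le> b" for a b d :: real
              using that by (auto simp: min_def)
            ultimately show ?thesis unfolding f_def by metis
          qed
          show "f x = 1" if "x \<notin> {3*h/2 - h/4..3*h/2 + h/4}" for x
          proof -
            have "x \<le> 3 * h / 2 - h / 4 \<or> 3 * h / 2 + h / 4 \<le> x" using that by auto
            then have "h / 4 \<le> \<bar>x - 3 * h / 2\<bar>" by linarith
            then show ?thesis using h by (simp add: f_def field_simps)
          qed
        qed (use f_meas h assms in auto)
        then show ?thesis using h K by (simp add: b_def ennreal_mult)
      qed
      ultimately have "ennreal_powr (ennreal a) (1 / p) \<le> ennreal C * ennreal_powr (ennreal b) (1 / p)"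
      proof -
        have "ennreal_powr (ennreal a) (1 / p) \<le> ennreal_powr A (1 / p)"
          using \<open>ennreal a \<le> A\<close> assms by (intro ennreal_powr_mono) auto
        also have "\<dots> \<le> ennreal C * ennreal_powr B (1 / p)"
          using bound[OF f_Lp] by (simp add: sobolev_seminorm_def A_def B_def g_def)
        also have "\<dots> \<le> ennreal C * ennreal_powr (ennreal b) (1 / p)"
          using \<open>B \<le> ennreal b\<close> assms by (intro mult_left_mono ennreal_powr_mono) auto
        finally show ?thesis .
      qed
      moreover have ab: "0 \<le> a" "0 \<le> b" using h K by (auto simp: a_def b_def)
      ultimately have "a powr (1 / p) \<le> C * b powr (1 / p)"
        using C by (simp add: ennreal_powr_ennreal ennreal_le_iff flip: ennreal_mult)
      then have "(a powr (1 / p)) powr p \<le> (C * b powr (1 / p)) powr p"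
        using assms by (intro powr_mono2) auto
      then have "a \<le> C powr p * b"
        using assms ab C by (simp add: powr_powr powr_mult)
      moreover have "a = h * c1 * e powr (- (\<sigma> * p))"
        using h by (simp add: a_def c1_def powr_add powr_minus_divide)
      moreover have "C powr p * b = h * c2 * h powr (- (s * p))"
        using h by (simp add: b_def c2_def powr_divide powr_minus_divide)
      ultimately have "h * (c1 * e powr (- (\<sigma> * p))) \<le> h * (c2 * h powr (- (s * p)))" by (simp add: mult.assoc)
      then have "c1 * e powr (- (\<sigma> * p)) \<le> c2 * h powr (- (s * p))" using h by simp
      \<comment> \<open>Moving the power of e to the right leaves a single power of h there, since e
        = h^M.\<close>
      then have "c1 * e powr (- (\<sigma> * p)) * e powr (\<sigma> * p) \<le> c2 * h powr (- (s * p)) * e powr (\<sigma> * p)"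
        by (intro mult_right_mono) auto
      moreover have "e powr (- (\<sigma> * p)) * e powr (\<sigma> * p) = 1"
        using h by (simp flip: powr_add)
      moreover have "h powr (- (s * p)) * e powr (\<sigma> * p) = h powr q"
      proof -
        have "e = h powr real M" using h by (simp add: e_def h_def powr_realpow power_mult)
        then show ?thesis by (simp add: powr_powr q_def algebra_simps flip: powr_add)
      qed
      moreover have "h powr q = ((1/2) powr q) ^ k"
        by (simp add: h_def powr_powr mult.commute flip: powr_realpow)
      ultimately show ?thesis by (simp add: mult.assoc)
    qed
    have "(1/2::real) powr q < 1"
      using powr_less_mono2[OF q, of "1/2" 1] by (simp only: powr_one_eq_one)
    \<comment> \<open>The upper bound in \<open>key\<close> decays geometrically, while
      \<open>c1\<close> is a fixed positive number.\<close>
    then have "(\<lambda>k. c2 * ((1/2) powr q) ^ k) \<longlonglongrightarrow> c2 * 0"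
      by (intro tendsto_mult tendsto_const LIMSEQ_power_zero) simp
    moreover have "\<forall>\<^sub>F k in sequentially. c1 \<le> c2 * ((1/2) powr q) ^ k"
      by (rule eventually_sequentiallyI[of 6]) (rule key)
    ultimately have "c1 \<le> c2 * 0"
      by (rule tendsto_lowerbound) (rule sequentially_bot)
    with c1 show False by simp
  qed
  show ?thesis
  proof (rule exI[of _ G], rule exI[of _ R], intro conjI ballI)
    show "\<not> (\<exists>C::real. C > 0 \<and> (\<forall>f\<in>Lp_on p G.
        sobolev_seminorm \<sigma> p G (\<lambda>x. enn2real (local_maximal R f x)) \<le> ennreal C * sobolev_seminorm s p G f))"
      if "\<sigma> \<in> {\<alpha> * s<..<1}" for \<sigma>
      using unbounded[OF that] by auto
  qed (use \<open>open G\<close> \<open>bounded G\<close> holder R_le in auto)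
qed

end
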